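(* Let $\{g_{n}^{(3)}(a,b,c;1)\}_{n=0}^{\infty}$ be the geometric mean sequence with initial values $g_{0}^{(3)}=a$, $g_{1}^{(3)}=b$, $g_{2}^{(3)}=c$, defined by the recurrence $g_{n+3}^{(3)}=\sqrt[3]{g_{n+2}^{(3)}g_{n+1}^{(3)}g_{n}^{(3)}}$ for $n\geq 0$. Then the sequence grows according to $$\lim_{n\rightarrow \infty}\frac{g_{n+1}^{(3)}(a,b,c;1)}{g_{n}^{(3)}(a,b,c;1)}=1.$$
   Context: The (scaled) geometric mean sequence $\{g_{n}^{(3)}(a,b,c;\epsilon)\}_{n=0}^{\infty}$ is defined, given $g_{0}^{(3)}=a$, $g_{1}^{(3)}=b$ and $g_{2}^{(3)}=c$, through the recurrence $g_{n+3}^{(3)}=\epsilon\sqrt[3]{g_{n+2}^{(3)}g_{n+1}^{(3)}g_{n}^{(3)}}$, $n\geq 0$, where $\epsilon\in\mathbb{N}$ is a scaling constant. The last argument $1$ in $g_{n}^{(3)}(a,b,c;1)$ means that $\epsilon=1$. The initial values are denoted $a,b,c$, with no further condition stated on them.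
   Formalization: The initial values a, b, c are assumed to be real, nonzero and of one common sign; otherwise the claim fails (e.g. a = -1, b = c = 1 gives ratios alternating between -1 and 1) or the quotients are undefined (if one of them is 0). *)

theory Defs
  imports Complex_Main
begin

text \<open>
  The scaling constant \<open>\<epsilon>\<close> is a natural number. The cube root is the real one: \<^term>\<open>root 3\<close> is
  defined on all of the reals and satisfies \<open>root 3 (- x) = - root 3 x\<close>.
\<close>

fun geom_mean_seq3 :: "real \<Rightarrow> real \<Rightarrow> real \<Rightarrow> nat \<Rightarrow> nat \<Rightarrow> real" where
  "geom_mean_seq3 a b c \<epsilon> 0 = a"
| "geom_mean_seq3 a b c \<epsilon> (Suc 0) = b"
| "geom_mean_seq3 a b c \<epsilon> (Suc (Suc 0)) = c"
| "geom_mean_seq3 a b c \<epsilon> (Suc (Suc (Suc n))) =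
     real \<epsilon> * root 3 (geom_mean_seq3 a b c \<epsilon> (Suc (Suc n)) *
                      geom_mean_seq3 a b c \<epsilon> (Suc n) *
                      geom_mean_seq3 a b c \<epsilon> n)"

end

theory Submission
  imports Defs
begin

text \<open>
  All terms have the same sign, and \<open>x n = ln \<bar>g n\<bar>\<close> satisfies the recurrence of the arithmetic
  mean of three consecutive terms. Its differences \<open>d n = x (n + 1) - x n\<close> obey
  \<open>3 d (n + 2) + 2 d (n + 1) + d n = 0\<close>. Both roots of \<open>3 t^2 + 2 t + 1\<close> have modulus
  \<open>1 / sqrt 3\<close>, so a positive definite quadratic form in \<open>(d n, d (n + 1))\<close> is divided by 3 in
  each step. Hence \<open>d n\<close> tends to 0, and the ratio \<open>g (n + 1) / g n = exp (d n)\<close> tends to 1.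
\<close>

lemma mean3_diff_tendsto_0:
  fixes x :: "nat \<Rightarrow> real"
  assumes rec: "\<And>n. x (n + 3) = (x (n + 2) + x (n + 1) + x n) / 3"
  shows "(\<lambda>n. x (n + 1) - x n) \<longlonglongrightarrow> 0"
proof -
  define d where "d n = x (n + 1) - x n" for n
  \<comment> \<open>For a root \<open>t\<close> of \<open>3 t^2 + 2 t + 1\<close> this is three times the squared modulus of
    \<open>d (n + 1) - t * d n\<close>.\<close>
  define W where "W n = 2 * (d (n + 1))\<^sup>2 + (d (n + 1) + d n)\<^sup>2" for n
  have d_rec: "d (Suc (Suc n)) = - (2 * d (n + 1) + d n) / 3" for n
    using rec[of n] by (simp add: d_def field_simps eval_nat_numeral)
  have W_Suc: "W (Suc n) = W n / 3" for n
    by (simp add: W_def d_rec power2_eq_square field_simps)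
  have W_eq: "W n = W 0 * (1 / 3) ^ n" for n
    by (induction n) (simp_all add: W_Suc)
  have "(\<lambda>n. W 0 * (1 / 3) ^ n) \<longlonglongrightarrow> 0"
    by (intro tendsto_mult_right_zero LIMSEQ_realpow_zero) simp_all
  then have "W \<longlonglongrightarrow> 0"
    by (simp flip: W_eq)
  \<comment> \<open>Squeeze between 0 and \<open>W n\<close>, which dominates
    \<open>(d (n + 1))\<^sup>2\<close>.\<close>
  then have "(\<lambda>n. (d (Suc n))\<^sup>2) \<longlonglongrightarrow> 0"
    by (rule tendsto_sandwich[rotated 2, OF tendsto_const])
      (simp_all add: W_def)
  then have "(\<lambda>n. d (Suc n)) \<longlonglongrightarrow> 0"
    by (simp add: power_tendsto_0_iff)
  then show ?thesis
    unfolding d_def by (subst (asm) filterlim_sequentially_Suc)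
qed

lemma sgn_cube: "sgn x * sgn x * sgn x = sgn (x :: real)"
  by (simp add: sgn_if)

text \<open>The real cube root keeps signs, and \<open>s * s * s = s\<close> for any sign
  \<open>s\<close>.\<close>

lemma sgn_geom_mean_seq3:
  assumes "sgn b = sgn a" "sgn c = sgn a" "\<epsilon> > 0"
  shows "sgn (geom_mean_seq3 a b c \<epsilon> n) = sgn a"
  using assms
  by (induction a b c \<epsilon> n rule: geom_mean_seq3.induct)
    (auto simp: sgn_mult sgn_root sgn_cube sgn_zero_iff)

text \<open>Mixed signs break the limit: from 1, 1, -1 the ratios alternate between 1 and -1. A zero
  initial value makes all terms from index 3 on zero, with \<open>0 / 0 = 0\<close>.\<close>

theorem theorem2p1:
  fixes a b c :: real
  assumes "(a > 0 \<and> b > 0 \<and> c > 0) \<or> (a < 0 \<and> b < 0 \<and> c < 0)"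
  shows "(\<lambda>n. geom_mean_seq3 a b c 1 (n + 1) / geom_mean_seq3 a b c 1 n) \<longlonglongrightarrow> 1"
proof -
  define g where "g = geom_mean_seq3 a b c 1"
  define x where "x n = ln \<bar>g n\<bar>" for n
  have sgn_g: "sgn (g n) = sgn a" for n
    unfolding g_def using assms by (intro sgn_geom_mean_seq3) auto
  moreover have "a \<noteq> 0"
    using assms by auto
  ultimately have g_nz: "g n \<noteq> 0" for n
    by (metis sgn_0_0)
  have "x (n + 3) = (x (n + 2) + x (n + 1) + x n) / 3" for n
  proof -
    \<comment> \<open>\<open>root 3\<close> is odd, so absolute values pass inside it even for
      negative terms.\<close>
    have "\<bar>g (n + 3)\<bar> = root 3 (\<bar>g (n + 2)\<bar> * \<bar>g (n + 1)\<bar> * \<bar>g n\<bar>)"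
      by (simp add: g_def eval_nat_numeral flip: real_root_abs abs_mult)
    then show ?thesis
      using g_nz by (simp add: x_def ln_root ln_mult)
  qed
  then have "(\<lambda>n. exp (x (n + 1) - x n)) \<longlonglongrightarrow> exp 0"
    by (intro tendsto_exp mean3_diff_tendsto_0)
  moreover have "exp (x (n + 1) - x n) = g (n + 1) / g n" for n
  proof -
    have "exp (x (n + 1) - x n) = \<bar>g (n + 1)\<bar> / \<bar>g n\<bar>"
      using g_nz by (simp add: x_def exp_diff)
    also have "\<dots> = g (n + 1) / g n"
      using sgn_g[of n] sgn_g[of "n + 1"] \<open>a \<noteq> 0\<close> g_nz by (simp add: abs_sgn sgn_eq_0_iff)
    finally show ?thesis .
  qed
  ultimately show ?thesis
    by (simp add: g_def)
qed

end
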